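(* Let $\lambda>0$ and $\mu_1\in\mathbb{R}\setminus\{0\}$ be real constants, let $n\ge 2$ be an integer, and suppose $h\in C^2((0,\infty))\cap C^1([0,\infty))$ is a solution of the problem $$2r^2h(r)h_{rr}(r)=(n-1)h(r)(h(r)-1)+rh_r(r)\big(rh_r(r)-\lambda r-(n-1)\big),\quad h(r)>0,\quad \forall r>0,\qquad h(0)=1,\quad h_r(0)=\mu_1. \qquad (P)$$ Then the following holds. (i) If $\mu_1=\lambda/n$, then the function $$h(r)=1+\frac{\lambda}{n}r\quad\forall r\ge 0$$ is the explicit analytic solution of $(P)$ on $[0,\infty)$. (ii) If $0<\mu_1<\lambda/n$, then $\lim_{r\to\infty}h_r(r)=0$, the limit $\lim_{r\to\infty}h(r)\in(1,\infty)$ exists, and $$1<h(r)\le 1+\mu_1r\quad\forall r>0.$$ (iii) If $\mu_1>\lambda/n$, then $$\lim_{r\to\infty}h_r(r)=\lim_{r\to\infty}h(r)=\infty$$ and $$h(r)\ge 1+\mu_1r\quad\forall r>0.$$ (iv) If $\mu_1<0$, then $\lim_{r\to\infty}h_r(r)=0$ and $\lim_{r\to\infty}h(r)$ exists and lies in $(0,1)$.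
   Context: Functions are real-valued; $h_r$ and $h_{rr}$ denote the first and second derivatives of $h$ in $r$. $C^1([0,\infty))$ means continuously differentiable up to $r=0$, with $h_r(0)$ the one-sided derivative at $0$. An analytic solution on $[0,\infty)$ is one that is real analytic at every point of $[0,\infty)$, including $r=0$. *)

theory Defs
  imports "HOL-Analysis.Analysis"
begin

text \<open>
  Functions on the half-line are total functions on the reals; only their values on
  \<open>{0..}\<close> matter. At an interior point the derivative is the library's \<^const>\<open>deriv\<close>;
  at \<open>0\<close> it is the one-sided derivative, so \<^const>\<open>deriv\<close> is never used there.
\<close>

definition C1_closed_half_line :: "(real \<Rightarrow> real) \<Rightarrow> bool" where
  "C1_closed_half_line h \<longleftrightarrow>
     (\<exists>D. (\<forall>r\<ge>0. (h has_real_derivative D r) (at r within {0..})) \<and> continuous_on {0..} D)"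

definition C2_open_half_line :: "(real \<Rightarrow> real) \<Rightarrow> bool" where
  "C2_open_half_line h \<longleftrightarrow>
     h C1_differentiable_on {0<..} \<and> deriv h C1_differentiable_on {0<..}"

definition solves_P :: "nat \<Rightarrow> real \<Rightarrow> real \<Rightarrow> (real \<Rightarrow> real) \<Rightarrow> bool" where
  "solves_P n lam \<mu> h \<longleftrightarrow>
     C2_open_half_line h \<and> C1_closed_half_line h \<and>
     (\<forall>r>0. 2 * r\<^sup>2 * h r * deriv (deriv h) r =
        (real n - 1) * h r * (h r - 1)
        + r * deriv h r * (r * deriv h r - lam * r - (real n - 1))) \<and>
     (\<forall>r>0. h r > 0) \<and>
     h 0 = 1 \<and>
     (h has_real_derivative \<mu>) (at 0 within {0..})"

text \<open>
  At a boundary point of \<open>S\<close> the expansion is required only on the side inside \<open>S\<close>. For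
  \<open>S = {0..}\<close> this is the same as \<open>f\<close> extending to a real analytic function near \<open>0\<close>, because
  a power series about \<open>0\<close> that converges on \<open>{0..<e}\<close> converges on \<open>{-e<..<e}\<close>.
\<close>

definition real_analytic_on :: "(real \<Rightarrow> real) \<Rightarrow> real set \<Rightarrow> bool" where
  "real_analytic_on f S \<longleftrightarrow>
     (\<forall>x\<in>S. \<exists>e>0. \<exists>a :: nat \<Rightarrow> real. \<forall>y\<in>S. \<bar>y - x\<bar> < e \<longrightarrow>
        (\<lambda>k. a k * (y - x) ^ k) sums f y)"

end

theory Submission
  imports Defs
begin

text \<open>
  Put \<open>m = n - 1\<close>, \<open>p = h'\<close>, \<open>q = (h - 1) / r\<close> and \<open>W = r\<^sup>2 q'\<close>. The equation becomes
  \<open>2 h W' + (m / r) W = r (m q\<^sup>2 + p\<^sup>2 - lam p)\<close>, where \<open>p = q + W / r\<close>; where \<open>W = 0\<close> the right-hand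
  side is \<open>r q (n q - lam)\<close>. For \<open>\<mu> > 0\<close> the sign of \<open>n \<mu> - lam\<close> is thus the sign of \<open>W\<close> for
  small \<open>r\<close>, and it persists: \<open>q\<close> moves away from \<open>lam / n\<close>, so \<open>W\<close> cannot return to zero. Hence \<open>q\<close> is
  monotone and tends to \<open>\<infinity>\<close> or to \<open>0\<close>. When \<open>q \<longlongrightarrow> 0\<close>, a barrier gives \<open>h' \<le> C (h / r)\<^sup>2\<close>, and
  integrating from a point where \<open>h / r\<close> is small shows that \<open>h\<close> is bounded. For \<open>\<mu> < 0\<close> the right-hand side is
  always positive, so \<open>-1 < r h' < 0\<close>, and a barrier gives \<open>-h' / h \<le> C / r\<^sup>2\<close>, which keeps \<open>h\<close>
  away from \<open>0\<close>. If \<open>\<mu> = lam / n\<close>, uniqueness at the singular point follows from a Gronwall estimate.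
\<close>

section \<open>Real-variable tools: barriers, a Gronwall bound, monotone limits\<close>

text \<open>If \<open>f r\<close> were nonpositive, \<open>f\<close> would have a nonpositive
  minimum over \<open>{a..r}\<close> at some point to the right of \<open>a\<close>, yet a positive
  derivative there gives smaller values just to the left. The start value may be 0, as it is for
  \<open>W\<close> at the origin.\<close>

lemma positive_if_increasing_where_nonpos:
  fixes f f' :: "real \<Rightarrow> real"
  assumes cont: "continuous_on {a..b} f" and start: "f a \<ge> 0"
    and der: "\<And>r. a < r \<Longrightarrow> r \<le> b \<Longrightarrow> (f has_real_derivative f' r) (at r)"
    and pos: "\<And>r. a < r \<Longrightarrow> r \<le> b \<Longrightarrow> f r \<le> 0 \<Longrightarrow> f' r > 0"
    and r: "a < r" "r \<le> b"
  shows "f r > 0"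
proof (rule ccontr)
  assume "\<not> f r > 0"
  then have fr: "f r \<le> 0" by simp
  have "continuous_on {a..r} f" using cont r by (auto intro: continuous_on_subset)
  then obtain x where x: "x \<in> {a..r}" "\<And>y. y \<in> {a..r} \<Longrightarrow> f x \<le> f y"
    using continuous_attains_inf[of "{a..r}" f] r by auto
  \<comment> \<open>A minimum at \<open>a\<close> can be moved to \<open>r\<close>: in that case
    \<open>f a >= 0 >= f r\<close>, so \<open>r\<close> is a minimiser too.\<close>
  obtain x' where x': "a < x'" "x' \<le> r" "f x' \<le> 0" "\<And>y. y \<in> {a..r} \<Longrightarrow> f x' \<le> f y"
  proof (cases "x = a")
    case True
    have "f r \<le> f y" if "y \<in> {a..r}" for y using x(2)[OF that] True start fr by simp
    then show ?thesis using that[of r] r fr by simp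
  next
    case False
    then show ?thesis using x(1) x(2)[of r] fr r by (intro that[of x] x(2)) auto
  qed
  have "f' x' > 0" using pos x' r by simp
  with DERIV_pos_inc_left[OF der] x' r
  obtain d where d: "d > 0" "\<And>k. 0 < k \<Longrightarrow> k < d \<Longrightarrow> f (x' - k) < f x'" by (metis order_trans)
  define k where "k = min (d/2) (x' - a)"
  have "0 < k" "k < d" "x' - k \<in> {a..r}" using d(1) x' by (auto simp: k_def min_def)
  then show False using d(2)[of k] x'(4)[of "x' - k"] by simp
qed

text \<open>At its first zero \<open>f\<close> would be positive on the left and yet increasing
  through 0. Because \<open>pos\<close> may use positivity on all of the past, sign information can
  first be integrated from \<open>a\<close> and then used at the zero.\<close>

lemma positive_if_increasing_at_first_zero:
  fixes f f' :: "real \<Rightarrow> real"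
  assumes cont: "continuous_on {a..} f" and start: "f a > 0"
    and der: "\<And>r. a < r \<Longrightarrow> (f has_real_derivative f' r) (at r)"
    and pos: "\<And>r. a < r \<Longrightarrow> f r = 0 \<Longrightarrow> (\<And>t. a \<le> t \<Longrightarrow> t < r \<Longrightarrow> f t > 0) \<Longrightarrow> f' r > 0"
    and r: "a \<le> r"
  shows "f r > 0"
proof (rule ccontr)
  assume fr: "\<not> f r > 0"
  define Z where "Z = {t \<in> {a..r}. f t = 0}"
  have contr: "continuous_on {a..r} f" using cont by (auto intro: continuous_on_subset)
  have "\<exists>t\<ge>a. t \<le> r \<and> f t = 0" using IVT2'[of f r 0 a] fr start r contr by auto
  then have ne: "Z \<noteq> {}" by (auto simp: Z_def)
  have "compact Z"
    unfolding Z_def using continuous_closed_preimage_constant[OF contr, of 0]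
    by (metis (no_types, lifting) closed_atLeastAtMost compact_eq_bounded_closed bounded_closed_interval bounded_subset mem_Collect_eq subsetI)
  then obtain x where x: "x \<in> Z" "\<And>y. y \<in> Z \<Longrightarrow> x \<le> y" using compact_attains_inf[of Z] ne by auto
  have xa: "a < x" using x(1) start by (cases "x = a") (auto simp: Z_def)
  have xr: "x \<le> r" "f x = 0" using x(1) by (auto simp: Z_def)
  have before: "f t > 0" if "a \<le> t" "t < x" for t
  proof (rule ccontr)
    assume ft: "\<not> f t > 0"
    have "continuous_on {a..t} f" using cont by (auto intro: continuous_on_subset)
    then have "\<exists>u\<ge>a. u \<le> t \<and> f u = 0" using ft start that by (intro IVT2') auto
    then obtain u where "a \<le> u" "u \<le> t" "f u = 0" by blast
    then show False using x(2)[of u] that xr by (auto simp: Z_def)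
  qed
  have "f' x > 0" using pos xa xr before by blast
  with DERIV_pos_inc_left[OF der[OF xa]]
  obtain d where d: "d > 0" "\<And>k. 0 < k \<Longrightarrow> k < d \<Longrightarrow> f (x - k) < f x" by metis
  define k where "k = min (d/2) (x - a)"
  have "0 < k" "k < d" "a \<le> x - k" using d(1) xa by (auto simp: k_def min_def)
  then show False using d(2)[of k] before[of "x - k"] xr by simp
qed

text \<open>The product \<open>E r * exp (-C * r)\<close> is nonincreasing. The differential
  inequality is asked only for \<open>0 < r\<close>, since the equation is singular at the
  origin.\<close>

lemma gronwall_zero:
  fixes E E' :: "real \<Rightarrow> real"
  assumes cont: "continuous_on {0..R} E" and start: "E 0 = 0"
    and der: "\<And>r. 0 < r \<Longrightarrow> r \<le> R \<Longrightarrow> (E has_real_derivative E' r) (at r)"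
    and le: "\<And>r. 0 < r \<Longrightarrow> r \<le> R \<Longrightarrow> E' r \<le> C * E r"
    and r: "0 \<le> r" "r \<le> R"
  shows "E r \<le> 0"
proof -
  have "E r * exp (-C * r) \<le> E 0 * exp (-C * 0)"
  proof (rule DERIV_nonpos_imp_decreasing_open[OF r(1)])
    fix x assume x: "0 < x" "x < r"
    have "((\<lambda>r. E r * exp (-C * r)) has_real_derivative (E' x - C * E x) * exp (-C * x)) (at x)"
      by (rule derivative_eq_intros der refl | use x r in \<open>simp add: algebra_simps\<close>)+
    moreover have "(E' x - C * E x) * exp (-C * x) \<le> 0"
      using le[of x] x r by (auto intro!: mult_nonpos_nonneg)
    ultimately show "\<exists>y. ((\<lambda>r. E r * exp (-C * r)) has_real_derivative y) (at x) \<and> y \<le> 0" by blast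
  next
    show "continuous_on {0..r} (\<lambda>r. E r * exp (-C * r))"
      using r by (intro continuous_intros continuous_on_subset[OF cont]) auto
  qed
  then show ?thesis using start by (simp add: mult_le_0_iff)
qed

lemma bounded_increasing_tendsto_at_top:
  fixes f :: "real \<Rightarrow> real"
  assumes mono: "\<And>x y. a \<le> x \<Longrightarrow> x \<le> y \<Longrightarrow> f x \<le> f y" and bound: "\<And>x. a \<le> x \<Longrightarrow> f x \<le> B"
  obtains L where "(f \<longlongrightarrow> L) at_top" "\<And>x. a \<le> x \<Longrightarrow> f x \<le> L" "L \<le> B"
proof -
  define L where "L = Sup (f ` {a..})"
  have bdd: "bdd_above (f ` {a..})" using bound by (auto intro!: bdd_aboveI)
  have le: "f x \<le> L" if "a \<le> x" for x
    unfolding L_def using that bdd by (auto intro!: cSup_upper)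
  have "(f \<longlongrightarrow> L) at_top"
  proof (rule order_tendstoI)
    fix c assume "c < L"
    then obtain x where x: "a \<le> x" "c < f x"
      unfolding L_def using less_cSup_iff[OF _ bdd] by auto
    then show "\<forall>\<^sub>F x in at_top. c < f x"
      unfolding eventually_at_top_linorder using mono by (meson less_le_trans)
  next
    fix c assume "L < c"
    then show "\<forall>\<^sub>F x in at_top. f x < c"
      unfolding eventually_at_top_linorder using le by (meson le_less_trans)
  qed
  moreover have "L \<le> B" unfolding L_def using bound by (auto intro!: cSup_least)
  ultimately show ?thesis using that le by blast
qed

section \<open>The equation in terms of the chord slope \<open>q\<close> and of
  \<open>W\<close>\<close>

text \<open>Here \<open>p\<close> and \<open>s\<close> stand for the first and second derivatives of
  \<open>h\<close>. As a parameter, \<open>p\<close> can take the one-sided derivative \<mu> as its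
  value at 0, where \<open>deriv h\<close> carries no information.\<close>

locale profile =
  fixes m lam \<mu> :: real and h p s :: "real \<Rightarrow> real"
  assumes m: "m \<ge> 1" and lam: "lam > 0"
    and h_deriv: "\<And>r. r > 0 \<Longrightarrow> (h has_real_derivative p r) (at r)"
    and p_deriv: "\<And>r. r > 0 \<Longrightarrow> (p has_real_derivative s r) (at r)"
    and eq: "\<And>r. r > 0 \<Longrightarrow>
      2 * r\<^sup>2 * h r * s r = m * h r * (h r - 1) + r * p r * (r * p r - lam * r - m)"
    and h_pos: "\<And>r. r > 0 \<Longrightarrow> h r > 0"
    and h0: "h 0 = 1"
    and h_deriv0: "(h has_real_derivative \<mu>) (at 0 within {0..})"
    and p_cont: "continuous_on {0..} p"
    and p0: "p 0 = \<mu>"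
begin

text \<open>The slope of the chord from \<open>(0, 1)\<close> to \<open>(r, h r)\<close>, extended
  to 0 by its limit.\<close>

definition q :: "real \<Rightarrow> real" where
  "q r = (if r = 0 then \<mu> else (h r - 1) / r)"

text \<open>The tangent to \<open>h\<close> at \<open>r\<close> meets the vertical axis at height
  \<open>1 - W r\<close>, so the sign of \<open>W\<close> tells on which side of
  \<open>(0, 1)\<close> it passes.\<close>

definition W :: "real \<Rightarrow> real" where
  "W r = r * p r - (h r - 1)"

lemma h_q: "h r = 1 + r * q r"
  using h0 by (simp add: q_def)

lemma p_q: "r > 0 \<Longrightarrow> p r = q r + W r / r"
  by (simp add: q_def W_def field_simps)

lemma h_cont: "continuous_on {0..} h"
  unfolding continuous_on_eq_continuous_within
proof
  fix x :: real assume "x \<in> {0..}"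
  then consider "x = 0" | "x > 0" by fastforce
  then show "continuous (at x within {0..}) h"
    by cases (use h_deriv0 DERIV_continuous in blast,
        use h_deriv DERIV_isCont continuous_at_imp_continuous_within in blast)
qed

lemma q_cont: "continuous_on {0..} q"
  unfolding continuous_on_eq_continuous_within
proof
  fix x :: real assume x: "x \<in> {0..}"
  show "continuous (at x within {0..}) q"
  proof (cases "x = 0")
    case True
    have "((\<lambda>r. (h r - 1) / r) \<longlongrightarrow> \<mu>) (at 0 within {0..})"
      using h_deriv0 unfolding has_field_derivative_iff by (simp add: h0)
    then have "(q \<longlongrightarrow> \<mu>) (at 0 within {0..})"
      by (rule Lim_transform_within[OF _ zero_less_one]) (auto simp: q_def)
    then show ?thesis by (simp add: continuous_within True q_def)
  next
    case False
    then have x0: "x > 0" using x by simp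
    have "isCont h x" using h_deriv[OF x0] by (rule DERIV_isCont)
    then have "isCont (\<lambda>r. (h r - 1) / r) x" using x0 by (intro continuous_intros) auto
    moreover have "\<forall>\<^sub>F r in nhds x. q r = (h r - 1) / r"
      by (rule eventually_mono[OF eventually_nhds_in_open[of "{0<..}" x]]) (use x0 in \<open>auto simp: q_def\<close>)
    ultimately have "isCont q x" by (subst isCont_cong)
    then show ?thesis by (rule continuous_at_imp_continuous_within)
  qed
qed

lemma W_cont: "continuous_on {0..} W"
  unfolding W_def by (intro continuous_intros p_cont h_cont)

lemma W0: "W 0 = 0"
  by (simp add: W_def h0)

lemma W_deriv: "r > 0 \<Longrightarrow> (W has_real_derivative r * s r) (at r)"
  unfolding W_def
  by (rule derivative_eq_intros h_deriv p_deriv refl | simp)+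

lemma q_deriv:
  assumes "r > 0" shows "(q has_real_derivative W r / r\<^sup>2) (at r)"
proof -
  have "((\<lambda>r. (h r - 1) / r) has_real_derivative W r / r\<^sup>2) (at r)"
    by (rule derivative_eq_intros h_deriv refl | use assms in \<open>simp add: W_def field_simps power2_eq_square\<close>)+
  then show ?thesis
    using assms by (rule has_field_derivative_transform_within[where d = r]) (auto simp: q_def dist_real_def)
qed

text \<open>Adding \<open>m * W r\<close> to the equation cancels the term
  \<open>- m * r * p r\<close> and turns \<open>m * h r * (h r - 1)\<close> into
  \<open>m * (h r - 1)\<^sup>2\<close>, which is \<open>m * (r * q r)\<^sup>2\<close>. What remains
  is divisible by \<open>r\<close>.\<close>

lemma W_eq:
  assumes "r > 0"
  shows "2 * h r * (r * s r) + m / r * W r = r * (m * (q r)\<^sup>2 + (p r)\<^sup>2 - lam * p r)"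
proof -
  have "r * (2 * h r * (r * s r) + m / r * W r) = r * (r * (m * (q r)\<^sup>2 + (p r)\<^sup>2 - lam * p r))"
  proof -
    have hq: "r * q r = h r - 1" using h_q[of r] by simp
    have "r * (r * (m * (q r)\<^sup>2)) = m * (r * q r)\<^sup>2" by (simp add: power2_eq_square)
    also have "\<dots> = m * (h r - 1)\<^sup>2" using hq by simp
    finally have 1: "r * (r * (m * (q r)\<^sup>2)) = m * (h r - 1)\<^sup>2" .
    have 2: "r * (2 * h r * (r * s r) + m / r * W r) = 2 * r\<^sup>2 * h r * s r + m * W r"
      using assms by (simp add: field_simps power2_eq_square)
    show ?thesis using 1 2 eq[OF assms] unfolding W_def by (simp add: algebra_simps power2_eq_square)
  qed
  then show ?thesis using assms by simp
qed

text \<open>Substituting \<open>p = q + W / r\<close> separates a part depending on \<open>q\<close>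
  alone, which decides the sign of \<open>W'\<close> at a zero of \<open>W\<close>, from a multiple
  of \<open>W\<close>.\<close>

lemma W_eq':
  assumes "r > 0"
  shows "2 * h r * (r * s r) =
    r * (q r * ((m + 1) * q r - lam) + W r / r * (2 * q r - lam + W r / r - m / r))"
proof -
  define x where "x = W r / r"
  have "m / r * W r = r * (x * (m / r))" using assms by (simp add: x_def)
  then have "2 * h r * (r * s r) + r * (x * (m / r)) = r * (m * (q r)\<^sup>2 + (q r + x)\<^sup>2 - lam * (q r + x))"
    using W_eq[OF assms] unfolding p_q[OF assms] x_def by simp
  then show ?thesis unfolding x_def[symmetric] by (simp add: algebra_simps power2_eq_square)
qed

section \<open>Signs of \<open>W\<close> and \<open>p\<close>, and growth of
  \<open>q\<close>\<close>

text \<open>At 0 both \<open>p\<close> and \<open>q\<close> equal \<mu>, so by continuity the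
  bracket in \<open>W_eq\<close>, multiplied by \<open>\<sigma>\<close>, stays positive for small
  \<open>r\<close>. Wherever \<open>\<sigma> * W r <= 0\<close>, the singular term
  \<open>m / r * W r\<close> only helps \<open>\<sigma> * W\<close> to grow, so this product is
  positive at once although it starts from 0. The factor \<open>\<sigma>\<close> covers both
  signs.\<close>

lemma W_sign_near_0:
  assumes "\<sigma> * (\<mu> * ((m + 1) * \<mu> - lam)) > 0"
  obtains d where "d > 0" "\<And>r. 0 < r \<Longrightarrow> r \<le> d \<Longrightarrow> \<sigma> * W r > 0"
proof -
  define F where "F r = \<sigma> * (m * (q r)\<^sup>2 + (p r)\<^sup>2 - lam * p r)" for r
  have "continuous_on {0..} F" unfolding F_def by (intro continuous_intros p_cont q_cont)
  moreover have "F 0 > 0" using assms by (simp add: F_def p0 q_def algebra_simps power2_eq_square)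
  ultimately obtain d where d: "d > 0" "\<And>r. r \<in> {0..} \<Longrightarrow> dist r 0 < d \<Longrightarrow> dist (F r) (F 0) < F 0"
    unfolding continuous_on_iff by (metis atLeast_iff order_refl)
  have F: "F r > 0" if "0 < r" "r \<le> d / 2" for r
    using d(2)[of r] that d(1) by (simp add: dist_real_def abs_less_iff)
  have "\<sigma> * W r > 0" if "0 < r" "r \<le> d / 2" for r
  proof (rule positive_if_increasing_where_nonpos[where a = 0 and b = "d/2" and f = "\<lambda>r. \<sigma> * W r" and f' = "\<lambda>r. \<sigma> * (r * s r)"])
    show "continuous_on {0..d/2} (\<lambda>r. \<sigma> * W r)"
      by (intro continuous_intros continuous_on_subset[OF W_cont]) auto
    show "((\<lambda>r. \<sigma> * W r) has_real_derivative \<sigma> * (r * s r)) (at r)" if "0 < r" for r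
      by (rule DERIV_cmult[OF W_deriv[OF that]])
    fix r assume r: "0 < r" "r \<le> d / 2" "\<sigma> * W r \<le> 0"
    have "2 * h r * (\<sigma> * (r * s r)) + m / r * (\<sigma> * W r) = r * F r"
      using arg_cong[OF W_eq[OF r(1)], of "\<lambda>x. \<sigma> * x"] by (simp add: F_def algebra_simps)
    moreover have "m / r * (\<sigma> * W r) \<le> 0"
      by (rule mult_nonneg_nonpos) (use r m in auto)
    moreover have "r * F r > 0" using F r by simp
    ultimately have "0 < 2 * h r * (\<sigma> * (r * s r))" by linarith
    then show "0 < \<sigma> * (r * s r)" using h_pos[OF r(1)] by (simp add: zero_less_mult_iff)
  qed (use that W0 in auto)
  then show ?thesis using that[of "d/2"] d(1) by simp
qed

text \<open>At a first zero of \<open>p\<close> the right-hand side of the equation reduces to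
  \<open>m * h r * (h r - 1)\<close>, which is positive because \<open>h\<close> has increased from
  1 up to that point.\<close>

lemma p_pos:
  assumes "\<mu> > 0" "r \<ge> 0" shows "p r > 0"
proof (rule positive_if_increasing_at_first_zero[OF p_cont _ p_deriv _ assms(2)])
  show "0 < p 0" using assms p0 by simp
  fix r :: real assume r: "0 < r" "p r = 0" and pos: "\<And>t. 0 \<le> t \<Longrightarrow> t < r \<Longrightarrow> 0 < p t"
  have "h 0 < h r"
    using r h_deriv pos
    by (intro DERIV_pos_imp_increasing_open[where f = h]) (auto intro!: continuous_on_subset[OF h_cont], metis less_imp_le)
  then have "0 < m * h r * (h r - 1)" using h0 h_pos r m by simp
  then have "0 < 2 * r\<^sup>2 * h r * s r" by (subst eq) (use r in auto)
  moreover have "0 < 2 * r\<^sup>2 * h r" using r h_pos by simp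
  ultimately show "0 < s r" by (simp only: zero_less_mult_pos)
qed

lemma h_gt_1:
  assumes "\<mu> > 0" "r > 0" shows "h r > 1"
proof -
  have "h 0 < h r"
    using assms h_deriv p_pos
    by (intro DERIV_pos_imp_increasing_open[where f = h]) (auto intro!: continuous_on_subset[OF h_cont], metis less_imp_le)
  then show ?thesis using h0 by simp
qed

lemma q_pos: "\<mu> > 0 \<Longrightarrow> r > 0 \<Longrightarrow> q r > 0"
  using h_gt_1 by (simp add: q_def)

lemma q_mono:
  assumes "0 \<le> a" "a \<le> b" "\<And>r. a < r \<Longrightarrow> r < b \<Longrightarrow> \<sigma> * W r \<ge> 0"
  shows "\<sigma> * q a \<le> \<sigma> * q b"
proof (rule DERIV_nonneg_imp_increasing_open[OF assms(2)])
  fix x assume x: "a < x" "x < b"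
  have "((\<lambda>r. \<sigma> * q r) has_real_derivative \<sigma> * (W x / x\<^sup>2)) (at x)"
    using x assms by (intro DERIV_cmult q_deriv) auto
  moreover have "\<sigma> * (W x / x\<^sup>2) = \<sigma> * W x / x\<^sup>2" by simp
  ultimately show "\<exists>y. ((\<lambda>r. \<sigma> * q r) has_real_derivative y) (at x) \<and> 0 \<le> y"
    using assms(3)[OF x] by (metis divide_nonneg_nonneg zero_le_power2)
next
  show "continuous_on {a..b} (\<lambda>r. \<sigma> * q r)"
    using assms by (intro continuous_intros continuous_on_subset[OF q_cont]) auto
qed

text \<open>Up to a first zero of \<open>W\<close> beyond \<open>d\<close> the product
  \<open>\<sigma> * q\<close> has not decreased, so \<open>\<sigma> * ((m + 1) * q r - lam)\<close>
  is still positive there. With \<open>W r = 0\<close>, \<open>W_eq'\<close> then makes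
  \<open>\<sigma> * W\<close> strictly increasing at that point.\<close>

lemma W_sign:
  assumes \<mu>: "\<mu> > 0" and sg: "\<sigma> * ((m + 1) * \<mu> - lam) > 0" and r: "r > 0"
  shows "\<sigma> * W r > 0"
proof -
  have "\<sigma> * (\<mu> * ((m + 1) * \<mu> - lam)) = \<mu> * (\<sigma> * ((m + 1) * \<mu> - lam))" by simp
  also have "\<dots> > 0" using \<mu> sg by simp
  finally obtain d where d: "d > 0" "\<And>r. 0 < r \<Longrightarrow> r \<le> d \<Longrightarrow> \<sigma> * W r > 0"
    using W_sign_near_0 by blast
  show ?thesis
  proof (cases "r \<le> d")
    case False
    show ?thesis
    proof (rule positive_if_increasing_at_first_zero[where a = d and f = "\<lambda>r. \<sigma> * W r" and f' = "\<lambda>r. \<sigma> * (r * s r)"])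
      show "continuous_on {d..} (\<lambda>r. \<sigma> * W r)"
        using d by (intro continuous_intros continuous_on_subset[OF W_cont]) auto
      show "((\<lambda>r. \<sigma> * W r) has_real_derivative \<sigma> * (r * s r)) (at r)" if "d < r" for r
        using that d by (intro DERIV_cmult W_deriv) auto
      fix r assume r: "d < r" "\<sigma> * W r = 0" and pos: "\<And>t. d \<le> t \<Longrightarrow> t < r \<Longrightarrow> 0 < \<sigma> * W t"
      have r0: "r > 0" using r d by simp
      have \<sigma>: "\<sigma> \<noteq> 0" using sg by auto
      then have W: "W r = 0" using r by simp
      have "\<sigma> * q 0 \<le> \<sigma> * q r"
      proof (rule q_mono)
        fix t assume "0 < t" "t < r"
        then show "0 \<le> \<sigma> * W t" using d(2)[of t] pos[of t] by (cases "t \<le> d") auto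
      qed (use r0 in auto)
      then have "(m + 1) * (\<sigma> * \<mu>) \<le> (m + 1) * (\<sigma> * q r)" using m by (simp add: q_def)
      then have "0 < \<sigma> * ((m + 1) * q r - lam)" using sg by (simp add: algebra_simps)
      then have "0 < (r * q r) * (\<sigma> * ((m + 1) * q r - lam))" using q_pos[OF \<mu> r0] r0 by simp
      also have "\<dots> = \<sigma> * (2 * h r * (r * s r))" unfolding W_eq'[OF r0] W by simp
      also have "\<dots> = 2 * h r * (\<sigma> * (r * s r))" by simp
      finally show "0 < \<sigma> * (r * s r)" using h_pos[OF r0] by (simp add: zero_less_mult_iff)
    qed (use d False in auto)
  qed (use d r in auto)
qed

text \<open>
  A bound \<open>\<sigma> q ((m + 1) q - lam) \<ge> c > 0\<close> forces \<open>\<sigma> W\<close> to grow linearly; since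
  \<open>q' = W / r\<^sup>2\<close>, the function \<open>\<sigma> q\<close> then grows logarithmically.
\<close>

lemma q_not_trapped:
  assumes \<sigma>: "\<bar>\<sigma>\<bar> = 1" and W_pos: "\<And>r. r > 0 \<Longrightarrow> \<sigma> * W r > 0"
    and q: "\<And>r. r \<ge> 1 \<Longrightarrow> 0 < q r" "\<And>r. r \<ge> 1 \<Longrightarrow> q r \<le> Q" and c: "c > 0"
    and drift: "\<And>r. r \<ge> 1 \<Longrightarrow> \<sigma> * (q r * ((m + 1) * q r - lam)) \<ge> c"
  shows False
proof -
  have Q: "Q > 0" using q[of 1] by simp
  \<comment> \<open>\<open>K\<close> bounds the factor of \<open>W r / r\<close> in
    \<open>W_eq'\<close> for \<open>r >= 1\<close>, as long as \<open>W r / r\<close> is at most 1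
    in absolute value.\<close>
  define K where "K = 2 * Q + lam + 1 + m"
  have K: "K > 0" using Q lam m by (simp add: K_def)
  \<comment> \<open>The three bounds serve in turn to make \<open>K\<close> applicable, to keep the
    \<open>W\<close> term of \<open>W_eq'\<close> below \<open>c / 2\<close>, and, together with
    \<open>h r <= r * (1 + Q)\<close>, to obtain \<open>2 * h r * e < r * (c / 2)\<close>.\<close>
  define e where "e = min 1 (min (c / (2 * K)) (c / (8 * (1 + Q))))"
  have e: "e > 0" "e \<le> 1" "e \<le> c / (2 * K)" "e \<le> c / (8 * (1 + Q))"
    using c K Q by (auto simp: e_def)
  have lin: "\<sigma> * W r - e * (r - 1) > 0" if "r \<ge> 1" for r
  proof (rule positive_if_increasing_at_first_zero[where a = 1 and f = "\<lambda>r. \<sigma> * W r - e * (r - 1)" and f' = "\<lambda>r. \<sigma> * (r * s r) - e"])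
    show "continuous_on {1..} (\<lambda>r. \<sigma> * W r - e * (r - 1))"
      by (intro continuous_intros continuous_on_subset[OF W_cont]) auto
    show "((\<lambda>r. \<sigma> * W r - e * (r - 1)) has_real_derivative \<sigma> * (r * s r) - e) (at r)" if "1 < r" for r
      by (rule derivative_eq_intros W_deriv refl | use that in simp)+
    fix r :: real assume r: "1 < r" "\<sigma> * W r - e * (r - 1) = 0"
    have r0: "r > 0" using r by simp
    define x where "x = W r / r"
    have "\<bar>W r\<bar> = \<bar>\<sigma> * W r\<bar>" using \<sigma> by (simp add: abs_mult)
    also have "\<dots> = e * (r - 1)" using r e by simp
    also have "\<dots> \<le> e * r" using e by simp
    finally have x: "\<bar>x\<bar> \<le> e" using r by (simp add: x_def field_simps)
    have "m / r \<le> m" using r m by (simp add: field_simps)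
    moreover have "0 \<le> m / r" using r m by simp
    ultimately have "\<bar>2 * q r - lam + x - m / r\<bar> \<le> K"
      using x q[of r] Q r e(2) lam m unfolding K_def abs_le_iff by linarith
    then have "\<bar>\<sigma> * (x * (2 * q r - lam + x - m / r))\<bar> \<le> e * K"
      using x \<sigma> e by (simp add: abs_mult mult_mono)
    moreover have "e * K \<le> c / 2" using e(3) K by (simp add: field_simps)
    moreover have "c \<le> \<sigma> * (q r * ((m + 1) * q r - lam))" using drift r by simp
    ultimately have "c / 2 \<le> \<sigma> * (q r * ((m + 1) * q r - lam)) + \<sigma> * (x * (2 * q r - lam + x - m / r))"
      by (simp add: abs_le_iff)
    then have "r * (c / 2) \<le> r * (\<sigma> * (q r * ((m + 1) * q r - lam)) + \<sigma> * (x * (2 * q r - lam + x - m / r)))"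
      using r by (intro mult_left_mono) auto
    also have "\<dots> = \<sigma> * (2 * h r * (r * s r))"
    proof -
      have "r * (\<sigma> * A + \<sigma> * B) = \<sigma> * (r * (A + B))" for A B by (simp add: algebra_simps)
      then show ?thesis unfolding W_eq'[OF r0] x_def[symmetric] .
    qed
    also have "\<dots> = 2 * h r * (\<sigma> * (r * s r))" by simp
    finally have 1: "r * (c / 2) \<le> 2 * h r * (\<sigma> * (r * s r))" .
    have "r * q r \<le> r * Q" using q[of r] r by simp
    moreover have "r * (1 + Q) = r + r * Q" by (simp add: distrib_left)
    ultimately have h: "h r \<le> r * (1 + Q)" using h_q[of r] r by linarith
    show "0 < \<sigma> * (r * s r) - e"
    proof (rule ccontr)
      assume "\<not> 0 < \<sigma> * (r * s r) - e"
      then have "\<sigma> * (r * s r) \<le> e" by simp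
      then have "2 * h r * (\<sigma> * (r * s r)) \<le> 2 * h r * e"
        using h_pos[OF r0] by (intro mult_left_mono) auto
      also have "\<dots> \<le> 2 * (r * (1 + Q)) * e"
        using h e(1) by (intro mult_right_mono) auto
      also have "\<dots> \<le> 2 * (r * (1 + Q)) * (c / (8 * (1 + Q)))"
        using e(4) r Q by (intro mult_left_mono) auto
      also have "\<dots> = r * (c / 4)" using Q by (simp add: field_simps)
      also have "\<dots> < r * (c / 2)" using r c by simp
      finally show False using 1 by simp
    qed
  qed (use that W_pos[of 1] in auto)
  \<comment> \<open>The integration starts at 2 because \<open>x - 1 >= x / 2\<close> from there on.
    With this \<open>R\<close>, \<open>e / 2 * (ln R - ln 2)\<close> equals
    \<open>2 * Q + e\<close>, more than \<open>\<sigma> * q\<close> can vary between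
    \<open>-Q\<close> and \<open>Q\<close>.\<close>
  define R where "R = 2 * exp (4 * Q / e + 2)"
  have "4 * Q / e + 2 \<ge> 0" using Q e by simp
  then have R: "R \<ge> 2" by (simp add: R_def)
  have "\<sigma> * q 2 - e / 2 * ln 2 \<le> \<sigma> * q R - e / 2 * ln R"
  proof (rule DERIV_nonneg_imp_nondecreasing[OF R])
    fix x :: real assume x: "2 \<le> x" "x \<le> R"
    have der: "((\<lambda>r. \<sigma> * q r - e / 2 * ln r) has_real_derivative \<sigma> * (W x / x\<^sup>2) - e / 2 * (1 / x)) (at x)"
      using x by (intro DERIV_diff DERIV_cmult q_deriv DERIV_ln_divide) auto
    have "e * (x - 1) \<ge> e * (x / 2)" using x e by (intro mult_left_mono) auto
    then have "(\<sigma> * W x - e * (x / 2)) / x\<^sup>2 \<ge> 0" using lin[of x] x by (intro divide_nonneg_nonneg) auto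
    also have "(\<sigma> * W x - e * (x / 2)) / x\<^sup>2 = \<sigma> * (W x / x\<^sup>2) - e / 2 * (1 / x)"
      using x by (simp add: diff_divide_distrib power2_eq_square)
    finally show "\<exists>y. ((\<lambda>r. \<sigma> * q r - e / 2 * ln r) has_real_derivative y) (at x) \<and> 0 \<le> y"
      using der by blast
  qed
  moreover have "ln R = ln 2 + (4 * Q / e + 2)" unfolding R_def by (simp add: ln_mult_pos)
  then have "e / 2 * ln R = e / 2 * ln 2 + 2 * Q + e"
    using e(1) by (simp only: distrib_left) simp
  moreover have "\<bar>\<sigma> * q 2\<bar> \<le> Q" "\<bar>\<sigma> * q R\<bar> \<le> Q"
    using q[of 2] q[of R] R \<sigma> by (simp_all add: abs_mult)
  ultimately show False using e(1) by linarith
qed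

section \<open>Uniqueness at the singular point in the critical case\<close>

text \<open>
  In terms of \<open>y = p - q\<close> and \<open>z = q - \<mu>\<close> the equation is a system with a regular
  singular point at \<open>0\<close>; the combination \<open>z + 2 / (m + 2) * y\<close> cancels the singular part of
  \<open>z' = y / r\<close>, and the singular term of \<open>y'\<close> has a good sign.
\<close>

lemma linear_solution:
  assumes \<mu>: "(m + 1) * \<mu> = lam" and r: "r \<ge> 0"
  shows "h r = 1 + \<mu> * r"
proof -
  define R where "R = r"
  \<comment> \<open>With this weight the coefficient \<open>2 * h t - b * (m + 2 * h t)\<close> of
    \<open>y t / t\<close> in the equation for \<open>u\<close> vanishes at 0, where
    \<open>h\<close> is 1. It equals \<open>b * m * (t * q t)\<close>, whose factor \<open>t\<close>
    cancels the singularity.\<close>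
  define b where "b = 2 / (m + 2)"
  have b: "0 < b" "b \<le> 1" using m by (auto simp: b_def)
  define y where "y t = p t - q t" for t
  define u where "u t = (q t - \<mu>) + b * y t" for t
  define E where "E t = (u t)\<^sup>2 + (y t)\<^sup>2" for t
  define y' where "y' t = s t - y t / t" for t
  define u' where "u' t = y t / t + b * y' t" for t
  \<comment> \<open>These are the regular terms. Since \<open>lam = (m + 1) * \<mu>\<close>, they
    vanish for \<open>y = 0\<close> and \<open>q = \<mu>\<close>, so on \<open>{0..R}\<close> they
    are bounded by a multiple of \<open>\<bar>u t\<bar> + \<bar>y t\<bar>\<close>.\<close>
  define N where "N t = (2 * q t - lam + y t) * y t + (m + 1) * q t * (q t - \<mu>)" for t
  have W_y: "W t = t * y t" if "t > 0" for t
    using p_q[OF that] that by (simp add: y_def)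
  have y_deriv: "(y has_real_derivative y' t) (at t)" if "t > 0" for t
    unfolding y_def[abs_def] y'_def
    by (rule derivative_eq_intros p_deriv q_deriv refl
        | use that W_y[OF that] in \<open>simp add: y_def power2_eq_square\<close>)+
  have u_deriv: "(u has_real_derivative u' t) (at t)" if "t > 0" for t
    unfolding u_def[abs_def] u'_def
    by (rule derivative_eq_intros y_deriv q_deriv refl
        | use that W_y[OF that] in \<open>simp add: power2_eq_square\<close>)+
  have y_eq: "2 * h t * y' t = N t - (m + 2 * h t) * (y t / t)" if "t > 0" for t
  proof -
    have "t * (2 * h t * s t) = t * (q t * ((m + 1) * q t - lam) + y t * (2 * q t - lam + y t - m / t))"
      using W_eq'[OF that] W_y[OF that] that by simp
    then have "2 * h t * s t = q t * ((m + 1) * q t - lam) + y t * (2 * q t - lam + y t - m / t)"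
      using that by simp
    then show ?thesis unfolding y'_def N_def \<mu>[symmetric] by (simp add: algebra_simps)
  qed
  have u_eq: "2 * h t * u' t = b * (m * q t * y t + N t)" if "t > 0" for t
  proof -
    have "(2 * h t - b * (m + 2 * h t)) * (m + 2) = b * m * (t * q t) * (m + 2)"
      unfolding b_def using m by (simp add: h_q[of t] field_simps)
    then have "2 * h t - b * (m + 2 * h t) = b * m * (t * q t)" using m by simp
    then have sing: "(2 * h t - b * (m + 2 * h t)) * (y t / t) = b * (m * q t * y t)" using that by simp
    have "2 * h t * u' t = 2 * h t * (y t / t) + b * (2 * h t * y' t)"
      unfolding u'_def by (simp only: distrib_left mult.left_commute)
    also have "\<dots> = (2 * h t - b * (m + 2 * h t)) * (y t / t) + b * N t"
      unfolding y_eq[OF that] by (simp only: right_diff_distrib left_diff_distrib mult.assoc)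
    also have "\<dots> = b * (m * q t * y t + N t)" unfolding sing by (simp only: distrib_left)
    finally show ?thesis .
  qed
  have y_cont: "continuous_on {0..} y" unfolding y_def[abs_def] by (intro continuous_intros p_cont q_cont)
  have sub: "continuous_on {0..R} f" if "continuous_on {0..} f" for f :: "real \<Rightarrow> real"
    using that by (rule continuous_on_subset) auto
  have bnd: "\<exists>B\<ge>0. \<forall>t\<in>{0..R}. \<bar>f t\<bar> \<le> B" if "continuous_on {0..} f" for f :: "real \<Rightarrow> real"
    by (rule continuous_on_compact_bound[OF compact_Icc sub[OF that]]) auto
  have h_nz: "h t > 0" if "t \<ge> 0" for t using h_pos[of t] h0 that by (cases "t = 0") auto
  have "continuous_on {0..} (\<lambda>t. 2 * q t - lam + y t)" by (intro continuous_intros q_cont y_cont)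
  then obtain B1 where B1: "B1 \<ge> 0" "\<forall>t\<in>{0..R}. \<bar>2 * q t - lam + y t\<bar> \<le> B1"
    using bnd by blast
  obtain B2 where B2: "B2 \<ge> 0" "\<forall>t\<in>{0..R}. \<bar>q t\<bar> \<le> B2"
    using bnd[OF q_cont] by blast
  have "continuous_on {0..} (\<lambda>t. 1 / h t)"
    by (intro continuous_intros h_cont) (use h_nz in force)
  then obtain H where H: "H \<ge> 0" "\<forall>t\<in>{0..R}. \<bar>1 / h t\<bar> \<le> H"
    using bnd by blast
  define B where "B = B1 + (m + 1) * B2"
  have B: "B \<ge> 0" using B1 B2 m by (simp add: B_def)
  \<comment> \<open>\<open>B\<close> bounds the coefficients of the regular terms and
    \<open>H\<close> bounds \<open>1 / h\<close>. The factor 6 arises from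
    \<open>3 * B * S\<^sup>2\<close> and \<open>S\<^sup>2 <= 2 * E t\<close>.\<close>
  have "E R \<le> 0"
  proof (rule gronwall_zero[where R = R and E = E and E' = "\<lambda>t. 2 * u t * u' t + 2 * y t * y' t" and C = "6 * B * H"])
    show "continuous_on {0..R} E"
      unfolding E_def[abs_def] u_def[abs_def] by (intro continuous_intros sub q_cont y_cont)
    show "E 0 = 0" by (simp add: E_def u_def y_def q_def p0)
    fix t assume t: "0 < t" "t \<le> R"
    show "(E has_real_derivative 2 * u t * u' t + 2 * y t * y' t) (at t)"
      unfolding E_def[abs_def]
      by (rule derivative_eq_intros u_deriv y_deriv refl | use t in simp)+
    define S where "S = \<bar>u t\<bar> + \<bar>y t\<bar>"
    have S: "S \<ge> 0" by (simp add: S_def)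
    have c1: "\<bar>2 * q t - lam + y t\<bar> \<le> B"
      using B1(2)[rule_format, of t] B2(1) t m by (simp add: B_def add_increasing2)
    have "(m + 1) * \<bar>q t\<bar> \<le> (m + 1) * B2" using B2(2)[rule_format, of t] t m by (intro mult_left_mono) auto
    moreover have "\<bar>(m + 1) * q t\<bar> = (m + 1) * \<bar>q t\<bar>" using m by (simp add: abs_mult)
    ultimately have c2: "\<bar>(m + 1) * q t\<bar> \<le> B" using B1(1) unfolding B_def by linarith
    have "\<bar>m * q t\<bar> \<le> \<bar>(m + 1) * q t\<bar>" using m by (simp add: abs_mult mult_right_mono)
    then have c3: "\<bar>m * q t\<bar> \<le> B" using c2 by simp
    have "\<bar>b * y t\<bar> \<le> \<bar>y t\<bar>" using b by (simp add: abs_mult mult_left_le_one_le)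
    then have z: "\<bar>q t - \<mu>\<bar> \<le> S" by (simp add: S_def u_def)
    have yS: "\<bar>y t\<bar> \<le> S" "\<bar>u t\<bar> \<le> S" by (auto simp: S_def)
    have "\<bar>N t\<bar> \<le> \<bar>2 * q t - lam + y t\<bar> * \<bar>y t\<bar> + \<bar>(m + 1) * q t\<bar> * \<bar>q t - \<mu>\<bar>"
      unfolding N_def by (metis abs_mult abs_triangle_ineq)
    also have "\<dots> \<le> B * S + B * S"
      using c1 c2 z yS B S by (intro add_mono mult_mono) auto
    finally have N: "\<bar>N t\<bar> \<le> 2 * B * S" by simp
    have "\<bar>m * q t * y t + N t\<bar> \<le> \<bar>m * q t\<bar> * \<bar>y t\<bar> + \<bar>N t\<bar>"
      by (metis abs_mult abs_triangle_ineq)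
    also have "\<bar>m * q t\<bar> * \<bar>y t\<bar> \<le> B * S" using c3 yS B by (intro mult_mono) auto
    finally have M: "\<bar>m * q t * y t + N t\<bar> \<le> 3 * B * S" using N by simp
    have "b * \<bar>m * q t * y t + N t\<bar> \<le> 1 * (3 * B * S)" using M b by (intro mult_mono) auto
    then have 1: "\<bar>2 * h t * u' t\<bar> \<le> 3 * B * S" unfolding u_eq[OF t(1)] using b by (simp add: abs_mult)
    have "u t * (2 * h t * u' t) \<le> \<bar>u t\<bar> * \<bar>2 * h t * u' t\<bar>" by (metis abs_ge_self abs_mult)
    also have "\<dots> \<le> \<bar>u t\<bar> * (3 * B * S)" using 1 by (intro mult_left_mono) auto
    finally have A1: "u t * (2 * h t * u' t) \<le> \<bar>u t\<bar> * (3 * B * S)" .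
    have "0 \<le> (m + 2 * h t) * ((y t)\<^sup>2 / t)" using m h_nz[of t] t by simp
    then have "y t * (2 * h t * y' t) \<le> y t * N t"
      unfolding y_eq[OF t(1)] by (simp add: algebra_simps power2_eq_square)
    also have "\<dots> \<le> \<bar>y t\<bar> * \<bar>N t\<bar>" by (metis abs_ge_self abs_mult)
    also have "\<dots> \<le> \<bar>y t\<bar> * (3 * B * S)"
      using N B S by (intro mult_left_mono) (auto intro: order_trans)
    finally have "h t * (2 * u t * u' t + 2 * y t * y' t) \<le> \<bar>u t\<bar> * (3 * B * S) + \<bar>y t\<bar> * (3 * B * S)"
      using A1 by (simp add: algebra_simps)
    also have "\<dots> = 3 * B * S\<^sup>2" by (simp add: S_def algebra_simps power2_eq_square)
    also have "S\<^sup>2 \<le> 2 * E t"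
      using sum_squares_ge_zero[of "\<bar>u t\<bar> - \<bar>y t\<bar>" 0] unfolding S_def E_def
      by (simp add: algebra_simps power2_eq_square)
    finally have "h t * (2 * u t * u' t + 2 * y t * y' t) \<le> 6 * B * E t" using B by (simp add: mult_left_mono)
    then have "2 * u t * u' t + 2 * y t * y' t \<le> 6 * B * E t * (1 / h t)"
      using h_nz[of t] t by (simp add: field_simps)
    also have "\<dots> \<le> 6 * B * E t * H"
      using H(2)[rule_format, of t] h_nz[of t] t B by (intro mult_left_mono) (auto simp: E_def)
    finally show "2 * u t * u' t + 2 * y t * y' t \<le> 6 * B * H * E t" by (simp add: mult_ac)
  qed (use r in \<open>auto simp: R_def\<close>)
  then have "u R = 0" "y R = 0" unfolding E_def by (auto simp: sum_power2_le_zero_iff)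
  then have "q R = \<mu>" by (simp add: u_def)
  then show ?thesis using h_q[of r] by (simp add: R_def)
qed

section \<open>Growth and decay in the remaining regimes\<close>

text \<open>Here \<open>W > 0\<close>, so \<open>q\<close> is nondecreasing, starts from \<mu> and
  lies below \<open>p\<close>. If \<open>q\<close> were bounded, the lower bound \<mu> on
  \<open>q\<close> would give a constant drift, which \<open>q_not_trapped\<close> excludes; hence
  \<open>q\<close> and with it \<open>p\<close> tend to infinity.\<close>

lemma superlinear_solution:
  assumes \<mu>: "\<mu> > 0" "(m + 1) * \<mu> > lam"
  shows "filterlim p at_top at_top" "filterlim h at_top at_top" "\<And>r. r > 0 \<Longrightarrow> h r \<ge> 1 + \<mu> * r"
proof -
  have W: "W r > 0" if "r > 0" for r using W_sign[of 1 r] \<mu> that by simp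
  have mono: "q a \<le> q b" if "0 \<le> a" "a \<le> b" for a b
    using q_mono[of a b 1] W that by (simp add: less_imp_le)
  have q\<mu>: "q r \<ge> \<mu>" if "r \<ge> 0" for r using mono[of 0 r] that by (simp add: q_def)
  show h: "h r \<ge> 1 + \<mu> * r" if "r > 0" for r
    using h_q[of r] q\<mu>[of r] that by (simp add: mult.commute)
  have "filterlim (\<lambda>r. 1 + \<mu> * r) at_top at_top"
    by (intro filterlim_tendsto_add_at_top[OF tendsto_const]
        filterlim_tendsto_pos_mult_at_top[OF tendsto_const \<mu>(1)] filterlim_ident)
  then show "filterlim h at_top at_top"
    by (rule filterlim_at_top_mono) (rule eventually_mono[OF eventually_gt_at_top[of 0] h])
  have pq: "p r > q r" if "r > 0" for r using p_q[OF that] W[OF that] that by simp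
  have unb: "\<exists>r\<ge>1. q r > Z" for Z
  proof (rule ccontr)
    assume "\<not> (\<exists>r\<ge>1. q r > Z)"
    then have Z: "q r \<le> Z" if "r \<ge> 1" for r using that by force
    show False
    proof (rule q_not_trapped[where \<sigma> = 1 and Q = Z and c = "\<mu> * ((m + 1) * \<mu> - lam)"])
      fix r :: real assume r: "r \<ge> 1"
      show "\<mu> * ((m + 1) * \<mu> - lam) \<le> 1 * (q r * ((m + 1) * q r - lam))"
        using q\<mu>[of r] r m \<mu> by (simp add: mult_mono)
      show "0 < q r" using q\<mu>[of r] r \<mu> by simp
    qed (use W Z \<mu> in auto)
  qed
  show "filterlim p at_top at_top"
    unfolding filterlim_at_top eventually_at_top_linorder
  proof
    fix Z
    obtain a where a: "a \<ge> 1" "q a > Z" using unb by blast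
    have "Z \<le> p r" if "r \<ge> a" for r using mono[of a r] pq[of r] a that by simp
    then show "\<exists>N. \<forall>r\<ge>N. Z \<le> p r" by blast
  qed
qed

text \<open>Here \<open>W < 0\<close>, so \<open>q\<close> is nonincreasing and
  \<open>0 < p < q\<close>; a positive lower bound on \<open>q\<close> is excluded by
  \<open>q_not_trapped\<close>, hence \<open>p\<close> tends to 0. The barrier \<open>G\<close>
  makes \<open>1 / h r - C / r\<close> nondecreasing, and its positivity at one point bounds the
  increasing function \<open>h\<close>.\<close>

lemma sublinear_solution:
  assumes \<mu>: "0 < \<mu>" "(m + 1) * \<mu> < lam"
  shows "(p \<longlongrightarrow> 0) at_top" "\<exists>L>1. (h \<longlongrightarrow> L) at_top" "\<And>r. r > 0 \<Longrightarrow> h r \<le> 1 + \<mu> * r"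
proof -
  have W: "W r < 0" if "r > 0" for r using W_sign[of "-1" r] \<mu> that by simp
  have mono: "q b \<le> q a" if "0 \<le> a" "a \<le> b" for a b
    using q_mono[of a b "-1"] W that by (simp add: less_imp_le)
  have q\<mu>: "q r \<le> \<mu>" if "r \<ge> 0" for r using mono[of 0 r] that by (simp add: q_def)
  show "h r \<le> 1 + \<mu> * r" if "r > 0" for r
    using h_q[of r] q\<mu>[of r] that by (simp add: mult.commute)
  have pq: "p r < q r" if "r > 0" for r
    using p_q[OF that] divide_neg_pos[OF W[OF that] that] by simp
  have small: "\<exists>a\<ge>1. \<forall>r\<ge>a. q r < e" if e: "e > 0" for e
  proof -
    have "\<exists>a\<ge>1. q a < e"
    proof (rule ccontr)
      assume "\<not> (\<exists>r\<ge>1. q r < e)"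
      then have q: "q r \<ge> e" if "r \<ge> 1" for r using that by force
      show False
      proof (rule q_not_trapped[where \<sigma> = "-1" and Q = \<mu> and c = "e * (lam - (m + 1) * \<mu>)"])
        fix r :: real assume r: "r \<ge> 1"
        have "(m + 1) * q r \<le> (m + 1) * \<mu>" using q\<mu>[of r] r m by simp
        then have "e * (lam - (m + 1) * \<mu>) \<le> q r * (lam - (m + 1) * q r)"
          using q[OF r] e \<mu> by (intro mult_mono) auto
        then show "e * (lam - (m + 1) * \<mu>) \<le> - 1 * (q r * ((m + 1) * q r - lam))"
          by (simp add: algebra_simps)
        show "0 < q r" using q[OF r] e by simp
      qed (use W q\<mu> \<mu> e in auto)
    qed
    then obtain a where a: "a \<ge> 1" "q a < e" by blast
    have "q r < e" if "r \<ge> a" for r using mono[of a r] a that by simp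
    then show ?thesis using a by blast
  qed
  show "(p \<longlongrightarrow> 0) at_top"
  proof (rule order_tendstoI)
    fix c :: real assume "c < 0"
    then show "\<forall>\<^sub>F r in at_top. c < p r"
      using p_pos[OF \<mu>(1)] by (intro eventually_mono[OF eventually_ge_at_top[of 0]]) (rule less_trans)
  next
    fix c :: real assume "0 < c"
    then obtain a where a: "a \<ge> 1" "\<forall>r\<ge>a. q r < c" using small by blast
    show "\<forall>\<^sub>F r in at_top. p r < c"
      unfolding eventually_at_top_linorder
    proof (intro exI allI impI)
      fix r assume "a \<le> r"
      then show "p r < c" using a(1) a(2)[rule_format, of r] pq[of r] by linarith
    qed
  qed
  \<comment> \<open>With this bound \<open>r * q r\<close> takes up one half of
    \<open>lam / 16 * r\<close>; the other half, for \<open>r >= 32 / lam\<close>, covers the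
    summand 1 of \<open>h\<close>. The bound on \<open>h\<close> keeps
    \<open>4 * r * p r * h r\<close> below a quarter of \<open>lam * (C * (h r)\<^sup>2)\<close>
    where the barrier is touched.\<close>
  obtain a where a: "a \<ge> 1" "\<And>r. r \<ge> a \<Longrightarrow> q r < lam / 32" using small[of "lam / 32"] lam by auto
  define a' where "a' = max a (32 / lam)"
  have a': "a' \<ge> 1" using a by (simp add: a'_def)
  have hr: "h r \<le> lam / 16 * r" if "r \<ge> a'" for r
  proof -
    have "r * q r \<le> r * (lam / 32)" using a that by (intro mult_left_mono) (auto simp: a'_def less_imp_le)
    moreover have "r * (lam / 32) \<ge> 1" using that lam by (simp add: a'_def field_simps)
    ultimately show ?thesis unfolding h_q[of r] by (simp add: mult.commute)
  qed
  \<comment> \<open>The first entry makes the barrier strict at \<open>a'\<close>. The second keeps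
    \<open>m * (h r)\<^sup>2\<close> below another quarter of
    \<open>lam * (C * (h r)\<^sup>2)\<close>, so that this term dominates at a point of
    contact.\<close>
  define C where "C = max (a'\<^sup>2 * p a' / (h a')\<^sup>2) (4 * m / lam) + 1"
  have C: "C > a'\<^sup>2 * p a' / (h a')\<^sup>2" "C > 4 * m / lam" by (auto simp: C_def)
  have "0 \<le> 4 * m / lam" using m lam by simp
  then have C0: "C > 0" using C(2) by linarith
  text \<open>For large \<open>r\<close> the equation reads \<open>h' \<approx> m / lam * (h / r)\<^sup>2\<close> up to terms of good sign.\<close>
  have G: "C - r\<^sup>2 * p r / (h r)\<^sup>2 > 0" if "r \<ge> a'" for r
  proof (rule positive_if_increasing_at_first_zero[where a = a' and f = "\<lambda>r. C - r\<^sup>2 * p r / (h r)\<^sup>2"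
        and f' = "\<lambda>r. (2 * r\<^sup>2 * (p r)\<^sup>2 - 2 * r * p r * h r - r\<^sup>2 * h r * s r) / (h r) ^ 3"])
    show "continuous_on {a'..} (\<lambda>r. C - r\<^sup>2 * p r / (h r)\<^sup>2)"
    proof (intro continuous_intros continuous_on_subset[OF p_cont] continuous_on_subset[OF h_cont])
      show "\<forall>x\<in>{a'..}. (h x)\<^sup>2 \<noteq> 0"
      proof
        fix x assume "x \<in> {a'..}"
        then have "h x > 0" using a' by (intro h_pos) auto
        then show "(h x)\<^sup>2 \<noteq> 0" by simp
      qed
    qed (use a' in auto)
    fix r assume r: "a' < r"
    have r0: "r > 0" using r a' by simp
    have hp: "h r > 0" using h_pos r0 .
    show "((\<lambda>r. C - r\<^sup>2 * p r / (h r)\<^sup>2) has_real_derivative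
        (2 * r\<^sup>2 * (p r)\<^sup>2 - 2 * r * p r * h r - r\<^sup>2 * h r * s r) / (h r) ^ 3) (at r)"
      by (rule derivative_eq_intros p_deriv h_deriv refl
          | use r0 hp in \<open>simp add: field_simps power2_eq_square power3_eq_cube\<close>)+
    assume "C - r\<^sup>2 * p r / (h r)\<^sup>2 = 0"
    then have Ceq: "r\<^sup>2 * p r = C * (h r)\<^sup>2" using hp by (simp add: field_simps)
    have pp: "p r > 0" using p_pos \<mu> r0 by simp
    have "r * (4 * r * p r * h r) = 4 * C * (h r)\<^sup>2 * h r" using Ceq by (simp add: power2_eq_square)
    also have "\<dots> \<le> 4 * C * (h r)\<^sup>2 * (lam / 16 * r)" using hr[of r] r C0 by (intro mult_left_mono) auto
    also have "\<dots> = r * (lam / 4 * (C * (h r)\<^sup>2))" by simp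
    finally have 2: "4 * r * p r * h r \<le> lam / 4 * (C * (h r)\<^sup>2)" using r0 by simp
    have 3: "m * h r * (h r - 1) < m * (h r)\<^sup>2" using hp m by (simp add: algebra_simps power2_eq_square)
    have 4: "0 \<le> m * r * p r" "0 \<le> r\<^sup>2 * (p r)\<^sup>2" using m r0 pp by auto
    have 5: "m * (h r)\<^sup>2 \<le> lam / 4 * (C * (h r)\<^sup>2)"
      using C(2) lam hp by (simp add: field_simps)
    have 6: "0 < lam * (C * (h r)\<^sup>2)" using lam C0 hp by simp
    have "4 * r * p r * h r + 2 * r\<^sup>2 * h r * s r - 4 * r\<^sup>2 * (p r)\<^sup>2
      = 4 * r * p r * h r + m * h r * (h r - 1) - 3 * (r\<^sup>2 * (p r)\<^sup>2) - lam * (C * (h r)\<^sup>2) - m * r * p r"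
      unfolding eq[OF r0] Ceq[symmetric] by (simp add: algebra_simps power2_eq_square)
    then have "4 * r * p r * h r + 2 * r\<^sup>2 * h r * s r - 4 * r\<^sup>2 * (p r)\<^sup>2 < 0"
      using 2 3 4 5 6 by linarith
    then show "0 < (2 * r\<^sup>2 * (p r)\<^sup>2 - 2 * r * p r * h r - r\<^sup>2 * h r * s r) / (h r) ^ 3"
      using hp by (intro divide_pos_pos) auto
  qed (use that C in auto)
  obtain c where c: "c \<ge> 1" "\<And>r. r \<ge> c \<Longrightarrow> q r < 1 / (4 * C)" using small[of "1 / (4 * C)"] C0 by auto
  \<comment> \<open>From \<open>R\<close> on both barrier and smallness of \<open>q\<close> hold,
    and \<open>R >= 4 * C\<close> absorbs the summand 1 of \<open>h\<close>. Thus
    \<open>h R <= R / (2 * C)\<close>, which is what makes \<open>K\<close> positive.\<close>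
  define R where "R = max (max a' c) (4 * C)"
  have R: "R \<ge> a'" "R \<ge> c" "R \<ge> 4 * C" "R \<ge> 1" using a' by (auto simp: R_def)
  have hR: "h R \<le> R / (2 * C)"
  proof -
    have "R * q R \<le> R * (1 / (4 * C))" using c(2)[of R] R by (intro mult_left_mono) auto
    moreover have "1 \<le> R * (1 / (4 * C))" using R C0 by (simp add: field_simps)
    ultimately show ?thesis unfolding h_q[of R] by simp
  qed
  define K where "K = 1 / h R - C / R"
  have "h R > 0" using h_pos R by simp
  then have K: "K > 0" using hR R C0 by (simp add: K_def field_simps)
  have bound: "h r \<le> 1 / K" if "r \<ge> R" for r
  proof -
    have "1 / h R - C / R \<le> 1 / h r - C / r"
    proof (rule DERIV_nonneg_imp_nondecreasing[OF that])
      fix x assume x: "R \<le> x" "x \<le> r"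
      have x0: "x > 0" "h x > 0" using x R h_pos by auto
      have "((\<lambda>r. 1 / h r - C / r) has_real_derivative (C - x\<^sup>2 * p x / (h x)\<^sup>2) / x\<^sup>2) (at x)"
        by (rule derivative_eq_intros h_deriv refl
            | use x0 in \<open>simp add: field_simps power2_eq_square\<close>)+
      moreover have "(C - x\<^sup>2 * p x / (h x)\<^sup>2) / x\<^sup>2 \<ge> 0" using G[of x] x R by simp
      ultimately show "\<exists>y. ((\<lambda>r. 1 / h r - C / r) has_real_derivative y) (at x) \<and> 0 \<le> y" by blast
    qed
    moreover have "C / r > 0" using C0 R that by simp
    ultimately have "K \<le> 1 / h r" by (simp add: K_def)
    then show ?thesis using K h_pos[of r] R that by (simp add: field_simps)
  qed
  have h_mono: "h x \<le> h y" if "R \<le> x" "x \<le> y" for x y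
  proof (rule DERIV_nonneg_imp_nondecreasing[OF that(2)])
    fix t assume "x \<le> t"
    then have "t > 0" using that R by simp
    then show "\<exists>D. (h has_real_derivative D) (at t) \<and> 0 \<le> D"
      using h_deriv[of t] p_pos[OF \<mu>(1), of t] by (intro exI[of _ "p t"]) simp
  qed
  obtain L where "(h \<longlongrightarrow> L) at_top" "h R \<le> L"
    using bounded_increasing_tendsto_at_top[of R h, OF h_mono bound] by (metis order_refl)
  then show "\<exists>L>1. (h \<longlongrightarrow> L) at_top" using h_gt_1[OF \<mu>(1), of R] R by (intro exI[of _ L]) auto
qed

text \<open>The first-zero argument gives \<open>p < 0\<close>, and then \<open>- lam * p\<close>
  makes the right-hand side of \<open>W_eq\<close> positive, so \<open>W > 0\<close>. This bounds
  \<open>r * p r\<close> below; the barrier \<open>G\<close> makes \<open>ln (h r) - C / r\<close>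
  nondecreasing, so the decreasing \<open>h\<close> cannot tend to 0.\<close>

lemma decreasing_solution:
  assumes \<mu>: "\<mu> < 0"
  shows "(p \<longlongrightarrow> 0) at_top" "\<exists>L. 0 < L \<and> L < 1 \<and> (h \<longlongrightarrow> L) at_top"
proof -
  have p_neg: "p r < 0" if "r \<ge> 0" for r
  proof -
    have "- p r > 0"
    proof (rule positive_if_increasing_at_first_zero[where f = "\<lambda>r. - p r" and f' = "\<lambda>r. - s r", OF _ _ _ _ that])
      show "continuous_on {0..} (\<lambda>r. - p r)" by (intro continuous_intros p_cont)
      show "0 < - p 0" using assms p0 by simp
      show "((\<lambda>r. - p r) has_real_derivative - s r) (at r)" if "0 < r" for r
        by (intro DERIV_minus p_deriv that)
      fix r :: real assume r: "0 < r" "- p r = 0" and pos: "\<And>t. 0 \<le> t \<Longrightarrow> t < r \<Longrightarrow> 0 < - p t"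
      have "h r < h 0"
        using r h_deriv pos
        by (intro DERIV_neg_imp_decreasing_open[where f = h]) (auto intro!: continuous_on_subset[OF h_cont], metis less_imp_le)
      then have "0 < m * h r * (1 - h r)" using h0 h_pos r m by simp
      also have "\<dots> = - (2 * r\<^sup>2 * h r * s r)" unfolding eq[OF r(1)] using r by (simp add: algebra_simps)
      also have "\<dots> = 2 * r\<^sup>2 * h r * (- s r)" by simp
      finally have "0 < 2 * r\<^sup>2 * h r * (- s r)" .
      moreover have "0 < 2 * r\<^sup>2 * h r" using r h_pos by simp
      ultimately show "0 < - s r" by (simp only: zero_less_mult_pos)
    qed
    then show ?thesis by simp
  qed
  have h_lt: "h b < h a" if "0 \<le> a" "a < b" for a b
    using that h_deriv p_neg
    by (intro DERIV_neg_imp_decreasing_open[where f = h]) (auto intro!: continuous_on_subset[OF h_cont], metis less_imp_le le_less_trans)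
  have h_lt_1: "h r < 1" if "r > 0" for r using h_lt[of 0 r] that h0 by simp
  have W_pos: "W r > 0" if r: "r > 0" for r
  proof (rule positive_if_increasing_where_nonpos[where a = 0 and b = r and f = W and f' = "\<lambda>r. r * s r"])
    show "continuous_on {0..r} W" by (rule continuous_on_subset[OF W_cont]) auto
    show "(W has_real_derivative t * s t) (at t)" if "0 < t" for t by (rule W_deriv[OF that])
    fix t assume t: "0 < t" "W t \<le> 0"
    have "lam * p t < 0" using p_neg[of t] t lam by (simp add: mult_pos_neg)
    moreover have "0 \<le> m * (q t)\<^sup>2" using m by simp
    ultimately have "0 < m * (q t)\<^sup>2 + (p t)\<^sup>2 - lam * p t"
      using zero_le_power2[of "p t"] by linarith
    then have "0 < t * (m * (q t)\<^sup>2 + (p t)\<^sup>2 - lam * p t)" using t by simp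
    moreover have "m / t * W t \<le> 0" using t m by (simp add: divide_nonpos_pos mult_nonneg_nonpos)
    ultimately have "0 < 2 * h t * (t * s t)" using W_eq[OF t(1)] by linarith
    then show "0 < t * s t" using h_pos[OF t(1)] by (simp add: zero_less_mult_iff)
  qed (use r W0 in auto)
  \<comment> \<open>\<open>W r > 0\<close> reads \<open>r * p r > h r - 1\<close>.\<close>
  have rp: "r * p r > - 1" if "r > 0" for r using W_pos[OF that] h_pos[OF that] by (simp add: W_def)
  show "(p \<longlongrightarrow> 0) at_top"
  proof (rule tendsto_sandwich[where f = "\<lambda>r. - 1 / r" and h = "\<lambda>r. 0"])
    show "\<forall>\<^sub>F r in at_top. - 1 / r \<le> p r"
      using eventually_gt_at_top[of 0]
      by eventually_elim (use rp in \<open>force simp: field_simps\<close>)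
    show "\<forall>\<^sub>F r in at_top. p r \<le> 0"
      using eventually_gt_at_top[of 0]
      by eventually_elim (use p_neg in \<open>simp add: less_imp_le\<close>)
    show "((\<lambda>r::real. - 1 / r) \<longlongrightarrow> 0) at_top"
      by (rule tendsto_divide_0[OF tendsto_const]) (simp add: filterlim_at_top_imp_at_infinity filterlim_ident)
  qed auto
  \<comment> \<open>From here on \<open>lam * r >= 8\<close>, which together with
    \<open>h r < 1\<close> keeps \<open>- (4 * r * p r * h r)\<close> below half of
    \<open>lam * (C * h r)\<close> at a point of contact.\<close>
  define a where "a = 8 / lam"
  have a: "a > 0" using lam by (simp add: a_def)
  \<comment> \<open>The first entry makes the barrier strict at \<open>a\<close>; the second lets
    the other half of \<open>lam * (C * h r)\<close> absorb \<open>m * h r\<close>.\<close>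
  define C where "C = max (- (a\<^sup>2 * p a / h a)) (2 * m / lam) + 1"
  have C: "C > - (a\<^sup>2 * p a / h a)" "C > 2 * m / lam" by (auto simp: C_def)
  have "0 \<le> 2 * m / lam" using m lam by simp
  then have C0: "C > 0" using C(2) by linarith
  have G: "C + r\<^sup>2 * p r / h r > 0" if "r \<ge> a" for r
  proof (rule positive_if_increasing_at_first_zero[where a = a and f = "\<lambda>r. C + r\<^sup>2 * p r / h r"
        and f' = "\<lambda>r. (2 * r * p r * h r + r\<^sup>2 * h r * s r - r\<^sup>2 * (p r)\<^sup>2) / (h r)\<^sup>2"])
    show "continuous_on {a..} (\<lambda>r. C + r\<^sup>2 * p r / h r)"
    proof (intro continuous_intros continuous_on_subset[OF p_cont] continuous_on_subset[OF h_cont])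
      show "\<forall>x\<in>{a..}. h x \<noteq> 0" using a h_pos by (metis atLeast_iff less_le_trans order_less_irrefl)
    qed (use a in auto)
    fix r assume r: "a < r"
    have r0: "r > 0" using r a by simp
    have hp: "h r > 0" using h_pos r0 .
    show "((\<lambda>r. C + r\<^sup>2 * p r / h r) has_real_derivative
        (2 * r * p r * h r + r\<^sup>2 * h r * s r - r\<^sup>2 * (p r)\<^sup>2) / (h r)\<^sup>2) (at r)"
      by (rule derivative_eq_intros p_deriv h_deriv refl
          | use r0 hp in \<open>simp add: field_simps power2_eq_square\<close>)+
    assume "C + r\<^sup>2 * p r / h r = 0"
    then have Ceq: "r\<^sup>2 * p r = - C * h r" using hp by (simp add: field_simps)
    have pn: "p r < 0" using p_neg r0 by simp
    \<comment> \<open>As \<open>r * p r\<close> lies between -1 and 0, the quadratic term is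
      outweighed by the linear one, and \<open>m >= 1\<close> only enlarges the latter.\<close>
    have "(r * p r)\<^sup>2 \<le> - (r * p r)"
    proof -
      have "(r * p r) * (1 + r * p r) \<le> 0" using rp[OF r0] mult_pos_neg[OF r0 pn] by (simp add: mult_nonpos_nonneg)
      then show ?thesis by (simp add: algebra_simps power2_eq_square)
    qed
    also have "\<dots> \<le> - (m * r * p r)"
      using mult_right_mono[of 1 m "- (r * p r)"] m pn r0 by (simp add: mult_nonneg_nonpos less_imp_le)
    finally have 1: "r\<^sup>2 * (p r)\<^sup>2 + m * r * p r \<le> 0" by (simp add: power_mult_distrib)
    have lr: "8 \<le> lam * r" using r lam by (simp add: a_def field_simps)
    have "r * (- (4 * r * p r * h r)) = - 4 * h r * (r\<^sup>2 * p r)" by (simp add: power2_eq_square)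
    also have "\<dots> = 4 * C * (h r * h r)" unfolding Ceq by simp
    also have "\<dots> \<le> 4 * C * (h r * 1)" using h_lt_1[OF r0] hp C0 by (intro mult_left_mono) auto
    also have "\<dots> \<le> (lam * r / 2) * (C * h r)" using lr C0 hp by (simp add: mult_right_mono)
    also have "\<dots> = r * (lam / 2 * (C * h r))" by simp
    finally have 2: "- (4 * r * p r * h r) \<le> lam / 2 * (C * h r)" using r0 by (simp only: mult_le_cancel_left_pos)
    have 3: "m * h r * (1 - h r) < m * h r" using hp m by (simp add: algebra_simps)
    have 4: "m * h r \<le> lam / 2 * (C * h r)" using C(2) lam hp by (simp add: field_simps)
    have "4 * r * p r * h r + 2 * r\<^sup>2 * h r * s r - 2 * r\<^sup>2 * (p r)\<^sup>2
      = 4 * r * p r * h r - m * h r * (1 - h r) - (r\<^sup>2 * (p r)\<^sup>2 + m * r * p r) + lam * (C * h r)"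
    proof -
      have "lam * (C * h r) = - lam * (r\<^sup>2 * p r)" unfolding Ceq by simp
      then show ?thesis unfolding eq[OF r0] by (simp add: algebra_simps power2_eq_square)
    qed
    then have "4 * r * p r * h r + 2 * r\<^sup>2 * h r * s r - 2 * r\<^sup>2 * (p r)\<^sup>2 > 0"
      using 1 2 3 4 by linarith
    then show "0 < (2 * r * p r * h r + r\<^sup>2 * h r * s r - r\<^sup>2 * (p r)\<^sup>2) / (h r)\<^sup>2"
      using hp by (intro divide_pos_pos) auto
  qed (use that C in auto)
  have below: "h r \<ge> h a * exp (- (C / a))" if "r \<ge> a" for r
  proof -
    have "ln (h a) - C / a \<le> ln (h r) - C / r"
    proof (rule DERIV_nonneg_imp_nondecreasing[OF that])
      fix x assume x: "a \<le> x" "x \<le> r"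
      have x0: "x > 0" "h x > 0" using x a h_pos by auto
      have "((\<lambda>r. ln (h r) - C / r) has_real_derivative (C + x\<^sup>2 * p x / h x) / x\<^sup>2) (at x)"
        by (rule derivative_eq_intros h_deriv refl
            | use x0 in \<open>simp add: field_simps power2_eq_square\<close>)+
      moreover have "(C + x\<^sup>2 * p x / h x) / x\<^sup>2 \<ge> 0" using G[of x] x by simp
      ultimately show "\<exists>y. ((\<lambda>r. ln (h r) - C / r) has_real_derivative y) (at x) \<and> 0 \<le> y" by blast
    qed
    moreover have "C / r > 0" using C0 a that by simp
    ultimately have "ln (h a) - C / a \<le> ln (h r)" by simp
    then have "exp (ln (h a) + - (C / a)) \<le> exp (ln (h r))" by simp
    then show ?thesis using h_pos[of a] h_pos[of r] a that by (simp only: exp_add) simp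
  qed
  obtain L where L: "((\<lambda>r. - h r) \<longlongrightarrow> L) at_top" "- h a \<le> L" "L \<le> - (h a * exp (- (C / a)))"
  proof (rule bounded_increasing_tendsto_at_top[of a "\<lambda>r. - h r" "- (h a * exp (- (C / a)))"])
    show "- h x \<le> - h y" if "a \<le> x" "x \<le> y" for x y
      using h_lt[of x y] that a by (cases "x = y") auto
  qed (use below that in auto)
  have "(h \<longlongrightarrow> - L) at_top" using tendsto_minus[OF L(1)] by simp
  moreover have "- L < 1" using L(2) h_lt_1[OF a] by simp
  moreover have "0 < h a * exp (- (C / a))" using h_pos[OF a] by simp
  then have "0 < - L" using L(3) by linarith
  ultimately show "\<exists>L. 0 < L \<and> L < 1 \<and> (h \<longlongrightarrow> L) at_top" by blast
qed

end

section \<open>From \<open>solves_P\<close> to the locale, and the explicit solution\<close>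

text \<open>The derivative supplied by \<open>C1_closed_half_line\<close> serves as
  \<open>p\<close>: it agrees with \<open>deriv h\<close> for \<open>r > 0\<close>, is continuous up
  to 0, and has the value \<mu> there by uniqueness of the one-sided derivative.\<close>

lemma profile_of_solution:
  assumes "lam > 0" "n \<ge> 2" and sol: "solves_P n lam \<mu> h"
  obtains p where "profile (real n - 1) lam \<mu> h p (deriv (deriv h))" "\<And>r. r > 0 \<Longrightarrow> deriv h r = p r"
proof -
  have C2: "C2_open_half_line h" and C1: "C1_closed_half_line h"
    and hd: "(h has_real_derivative \<mu>) (at 0 within {0..})"
    using sol by (auto simp: solves_P_def)
  obtain D where D: "\<And>r. r \<ge> 0 \<Longrightarrow> (h has_real_derivative D r) (at r within {0..})" "continuous_on {0..} D"
    using C1 by (auto simp: C1_closed_half_line_def)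
  have Dh: "(h has_real_derivative D r) (at r)" if "r > 0" for r
  proof -
    have "at r within {0..} = at r" using that by (intro at_within_open_subset[of r "{0<..}"]) auto
    then show ?thesis using D(1)[of r] that by simp
  qed
  have dh: "deriv h r = D r" if "r > 0" for r using Dh[OF that] by (rule DERIV_imp_deriv)
  have "deriv h differentiable at r" if "r > 0" for r
    using C2 that by (auto simp: C2_open_half_line_def C1_differentiable_on_eq)
  then have ddh: "(deriv h has_real_derivative deriv (deriv h) r) (at r)" if "r > 0" for r
    using that DERIV_deriv_iff_real_differentiable by blast
  have Dd: "(D has_real_derivative deriv (deriv h) r) (at r)" if "r > 0" for r
    using ddh[OF that] that
    by (rule has_field_derivative_transform_within[where d = r]) (auto simp: dh dist_real_def)
  have D0: "D 0 = \<mu>"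
  proof -
    have "at_right (0::real) \<le> at 0 within {0..}" by (rule at_le) auto
    then have "at (0::real) within {0..} \<noteq> bot"
      using trivial_limit_at_right_real[of "0::real"] le_bot by fastforce
    then show ?thesis using has_field_derivative_unique[OF D(1) hd] by simp
  qed
  have "profile (real n - 1) lam \<mu> h D (deriv (deriv h))"
    by unfold_locales (use assms Dh Dd D D0 hd dh in \<open>auto simp: solves_P_def\<close>)
  then show ?thesis using that dh by blast
qed

text \<open>Both sides of the equation vanish: for \<open>k = lam / n\<close> one has
  \<open>r * k - lam * r - (n - 1) = - (n - 1) * (1 + k * r)\<close>.\<close>

lemma linear_solves_P:
  assumes "lam > 0" "n \<ge> 2"
  shows "solves_P n lam (lam / real n) (\<lambda>r. 1 + lam / real n * r)"
proof -
  define k where "k = lam / real n"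
  have k: "k > 0" "real n * k = lam" using assms by (auto simp: k_def)
  have der: "((\<lambda>r. 1 + k * r) has_real_derivative k) (at r within S)" for r S
    by (rule derivative_eq_intros refl | simp)+
  have d1: "deriv (\<lambda>r. 1 + k * r) = (\<lambda>_. k)" using der by (intro ext DERIV_imp_deriv)
  have "solves_P n lam k (\<lambda>r. 1 + k * r)"
    unfolding solves_P_def
  proof (intro conjI allI impI)
    show "C2_open_half_line (\<lambda>r. 1 + k * r)"
      unfolding C2_open_half_line_def d1 by (auto intro!: derivative_intros)
    show "C1_closed_half_line (\<lambda>r. 1 + k * r)"
      unfolding C1_closed_half_line_def using der by (intro exI[of _ "\<lambda>_. k"]) auto
    fix r :: real
    show "2 * r\<^sup>2 * (1 + k * r) * deriv (deriv (\<lambda>r. 1 + k * r)) r =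
        (real n - 1) * (1 + k * r) * ((1 + k * r) - 1)
        + r * deriv (\<lambda>r. 1 + k * r) r * (r * deriv (\<lambda>r. 1 + k * r) r - lam * r - (real n - 1))"
      unfolding d1 k(2)[symmetric] by (simp add: algebra_simps)
    show "0 < 1 + k * r" if "0 < r" using that k by (simp add: add_pos_pos)
  qed (use der in auto)
  then show ?thesis by (simp add: k_def)
qed

lemma real_analytic_on_affine: "real_analytic_on (\<lambda>r. a + b * r) S"
  unfolding real_analytic_on_def
proof (intro ballI exI[of _ 1] conjI)
  fix x :: real
  define c where "c k = (if k = 0 then a + b * x else if k = 1 then b else 0)" for k :: nat
  have "(\<lambda>k. c k * (y - x) ^ k) sums (a + b * y)" for y
  proof -
    have "(\<lambda>k. c k * (y - x) ^ k) sums (\<Sum>k\<in>{0, 1}. c k * (y - x) ^ k)"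
      by (rule sums_finite) (auto simp: c_def)
    then show ?thesis by (simp add: c_def algebra_simps)
  qed
  then show "\<exists>c. \<forall>y\<in>S. \<bar>y - x\<bar> < 1 \<longrightarrow> (\<lambda>k. c k * (y - x) ^ k) sums (a + b * y)" by blast
qed simp

theorem theorem1p8:
  fixes n :: nat and lam \<mu>1 :: real and h :: "real \<Rightarrow> real"
  assumes "lam > 0" and "\<mu>1 \<noteq> 0" and "n \<ge> 2"
    and "solves_P n lam \<mu>1 h"
  shows "(\<mu>1 = lam / real n \<longrightarrow>
            solves_P n lam \<mu>1 (\<lambda>r. 1 + lam / real n * r) \<and>
            real_analytic_on (\<lambda>r. 1 + lam / real n * r) {0..} \<and>
            (\<forall>r\<ge>0. h r = 1 + lam / real n * r))
       \<and> (0 < \<mu>1 \<and> \<mu>1 < lam / real n \<longrightarrow>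
            (deriv h \<longlongrightarrow> 0) at_top \<and>
            (\<exists>L>1. (h \<longlongrightarrow> L) at_top) \<and>
            (\<forall>r>0. 1 < h r \<and> h r \<le> 1 + \<mu>1 * r))
       \<and> (\<mu>1 > lam / real n \<longrightarrow>
            filterlim (deriv h) at_top at_top \<and>
            filterlim h at_top at_top \<and>
            (\<forall>r>0. h r \<ge> 1 + \<mu>1 * r))
       \<and> (\<mu>1 < 0 \<longrightarrow>
            (deriv h \<longlongrightarrow> 0) at_top \<and>
            (\<exists>L. 0 < L \<and> L < 1 \<and> (h \<longlongrightarrow> L) at_top))"
proof -
  obtain p where P: "profile (real n - 1) lam \<mu>1 h p (deriv (deriv h))" and dh: "\<And>r. r > 0 \<Longrightarrow> deriv h r = p r"
    using profile_of_solution[of lam n \<mu>1 h] assms by blast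
  interpret profile "real n - 1" lam \<mu>1 h p "deriv (deriv h)" by (rule P)
  \<comment> \<open>Limits at infinity see only large \<open>r\<close>, so \<open>p\<close> may
    replace \<open>deriv h\<close> in them.\<close>
  have ev: "\<forall>\<^sub>F r in at_top. deriv h r = p r"
    using eventually_gt_at_top[of 0] by eventually_elim (rule dh)
  have lim: "filterlim (deriv h) F at_top \<longleftrightarrow> filterlim p F at_top" for F
    by (rule filterlim_cong[OF refl refl ev])
  have n: "real n - 1 + 1 = real n" "real n > 0" using assms by auto
  have cmp: "\<mu>1 < lam / real n \<longleftrightarrow> (real n - 1 + 1) * \<mu>1 < lam"
    "\<mu>1 > lam / real n \<longleftrightarrow> (real n - 1 + 1) * \<mu>1 > lam"
    "\<mu>1 = lam / real n \<longleftrightarrow> (real n - 1 + 1) * \<mu>1 = lam"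
    using n by (auto simp: field_simps)
  have pos: "\<mu>1 > 0" if "\<mu>1 > lam / real n"
    using that n assms(1) by (metis divide_pos_pos less_trans)
  show ?thesis
  proof (intro conjI impI)
    assume \<mu>: "\<mu>1 = lam / real n"
    show "solves_P n lam \<mu>1 (\<lambda>r. 1 + lam / real n * r)"
      unfolding \<mu> using assms by (intro linear_solves_P)
    show "real_analytic_on (\<lambda>r. 1 + lam / real n * r) {0..}" by (rule real_analytic_on_affine)
    show "\<forall>r\<ge>0. h r = 1 + lam / real n * r" using linear_solution cmp \<mu> by auto
  next
    assume \<mu>: "0 < \<mu>1 \<and> \<mu>1 < lam / real n"
    then have \<mu>': "0 < \<mu>1" "(real n - 1 + 1) * \<mu>1 < lam" using cmp by auto
    show "(deriv h \<longlongrightarrow> 0) at_top" unfolding lim by (rule sublinear_solution[OF \<mu>'])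
    show "\<exists>L>1. (h \<longlongrightarrow> L) at_top" by (rule sublinear_solution[OF \<mu>'])
    show "\<forall>r>0. 1 < h r \<and> h r \<le> 1 + \<mu>1 * r"
      using sublinear_solution(3)[OF \<mu>'] h_gt_1[OF \<mu>'(1)] by blast
  next
    assume \<mu>: "\<mu>1 > lam / real n"
    then have \<mu>': "0 < \<mu>1" "(real n - 1 + 1) * \<mu>1 > lam" using cmp pos by auto
    show "filterlim (deriv h) at_top at_top" unfolding lim by (rule superlinear_solution[OF \<mu>'])
    show "filterlim h at_top at_top" by (rule superlinear_solution[OF \<mu>'])
    show "\<forall>r>0. h r \<ge> 1 + \<mu>1 * r" using superlinear_solution(3)[OF \<mu>'] by blast
  next
    assume \<mu>: "\<mu>1 < 0"
    show "(deriv h \<longlongrightarrow> 0) at_top" unfolding lim by (rule decreasing_solution[OF \<mu>])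
    show "\<exists>L. 0 < L \<and> L < 1 \<and> (h \<longlongrightarrow> L) at_top" by (rule decreasing_solution[OF \<mu>])
  qed
qed

end
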